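(* Let $k \ge 2$ be an integer. Let $a$ be a nonnegative integer satisfying $a \le \lfloor k!\,e \rfloor - R_k(3) + 1$, and let $q = a/k!$. Then $R_n(3) \le n!(e-q)+1$ for all integers $n \ge k$.
   Context: For an integer $n \ge 1$, the $n$-color Ramsey number $R_n(3) = R(3,\dots,3)$ denotes the smallest positive integer $N$ such that, for any coloring of the edges of the complete graph $K_N$ with $n$ colors, there is a monochromatic triangle. Here $e$ denotes the base of the natural logarithm, and $\lfloor x \rfloor$ is the integer part (floor) of the real number $x$. *)

theory Defs
  imports Complex_Main "HOL-Library.Ramsey"
begin

text \<open>
  The edges of the complete graph on \<open>N\<close> vertices are the members of \<open>nsets {..<N} 2\<close>.
  Thus \<open>partn {..<N} 3 2 {..<n}\<close> says that every colouring of these edges with colours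
  \<open>{..<n}\<close> (not all of which need be used) has a colour \<open>i < n\<close> and a 3-element set of
  vertices all of whose edges have colour \<open>i\<close>, i.e. a monochromatic triangle.
\<close>

definition ramsey3 :: "nat \<Rightarrow> nat"
  where "ramsey3 n = (LEAST N. N > 0 \<and> partn {..<N} 3 2 {..<n})"

text \<open>The minimum is taken over a nonempty set, so \<open>LEAST\<close> denotes an actual minimum.\<close>

lemma ramsey3_ex: "\<exists>N>0. partn {..<N::nat} 3 2 {..<n::nat}"
proof -
  obtain N :: nat where N: "partn_lst {..<N} (replicate n 3) 2"
    using ramsey_full by blast
  have "partn_lst {..<Suc N} (replicate n 3) 2"
    by (rule partn_lst_greater_resource [OF N]) simp
  then have "partn {..<Suc N} 3 2 {..<n::nat}"
    by (fastforce simp: partn_lst_def partn_def)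
  then show ?thesis
    by blast
qed

lemma ramsey3: "ramsey3 n > 0" "partn {..<ramsey3 n} 3 2 {..<n::nat}"
  using LeastI_ex [OF ramsey3_ex [of n]] by (simp_all add: ramsey3_def)

end

theory Submission
  imports Defs
begin

text \<open>
  With \<open>S\<^sub>n = (\<Sum>j\<le>n. 1 / j!)\<close>, the pigeonhole bound \<open>R\<^sub>n\<^sub>+\<^sub>1 - 1 \<le> (n + 1) (R\<^sub>n - 1) + 1\<close> says that
  \<open>(R\<^sub>n - 1) / n! - S\<^sub>n\<close> is nonincreasing in \<open>n\<close>. Since \<open>\<lfloor>k! e\<rfloor> = k! S\<^sub>k\<close>, the assumption on \<open>a\<close>
  says that this quantity is at most \<open>- q\<close> for \<open>n = k\<close>. Finally \<open>S\<^sub>n \<le> e\<close>.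
\<close>

lemma monochromatic_image:
  assumes "inj_on h A" "h ` A \<subseteq> B" "monochromatic A \<alpha> \<gamma> (\<lambda>X. f (h ` X)) i"
  shows "monochromatic B \<alpha> \<gamma> f i"
proof -
  obtain H where H: "H \<in> nsets A \<alpha>" and mono: "(\<lambda>X. f (h ` X)) ` nsets H \<gamma> \<subseteq> {i}"
    using assms(3) by (auto simp: monochromatic_def)
  have "bij_betw h H (h ` H)"
    using assms(1) H by (auto simp: nsets_def bij_betw_def intro: inj_on_subset)
  then have "nsets (h ` H) \<gamma> = (`) h ` nsets H \<gamma>"
    by (rule bij_betw_nsets[THEN bij_betw_imp_surj_on, symmetric])
  moreover have "h ` H \<in> nsets B \<alpha>"
    using H assms(1,2) by (auto simp: nsets_def intro!: card_image inj_on_subset[of h A])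
  ultimately show ?thesis
    using mono unfolding monochromatic_def by (intro bexI[of _ "h ` H"]) (auto simp: image_image)
qed

lemma monochromatic_relabel:
  assumes "inj_on g C" "f \<in> nsets A \<gamma> \<rightarrow> C" "i \<in> C" "monochromatic A \<alpha> \<gamma> (g \<circ> f) (g i)"
  shows "monochromatic A \<alpha> \<gamma> f i"
proof -
  obtain H where H: "H \<in> nsets A \<alpha>" and mono: "\<And>X. X \<in> nsets H \<gamma> \<Longrightarrow> g (f X) = g i"
    using assms(4) by (fastforce simp: monochromatic_def)
  have "f X = i" if "X \<in> nsets H \<gamma>" for X
  proof -
    have "X \<in> nsets A \<gamma>"
      using that H by (auto simp: nsets_def)
    then show ?thesis
      using mono[OF that] assms(1-3) by (auto dest: inj_onD)
  qed
  then show ?thesis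
    using H by (auto simp: monochromatic_def)
qed

text \<open>Serves to move the defining property of \<open>ramsey3 n\<close> from the standard
  vertices and colours to any vertex set at least as large and any set of \<open>n\<close>
  colours.\<close>

lemma partn_transfer:
  assumes "partn A \<alpha> \<gamma> C" "inj_on h A" "h ` A \<subseteq> B" "bij_betw g D C"
  shows "partn B \<alpha> \<gamma> D"
  unfolding partn_def
proof
  fix f assume f: "f \<in> nsets B \<gamma> \<rightarrow> D"
  have f': "(\<lambda>X. f (h ` X)) \<in> nsets A \<gamma> \<rightarrow> D"
    using nsets_compose_image_funcset[OF f, of h A] assms(2,3) by (auto simp: comp_def)
  then have "g \<circ> (\<lambda>X. f (h ` X)) \<in> nsets A \<gamma> \<rightarrow> C"
    using bij_betwE[OF assms(4)] by auto
  then obtain j where "j \<in> C" "monochromatic A \<alpha> \<gamma> (g \<circ> (\<lambda>X. f (h ` X))) j"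
    using assms(1) unfolding partn_def by blast
  moreover from this obtain i where "i \<in> D" "j = g i"
    using assms(4) by (auto simp: bij_betw_def)
  ultimately have "i \<in> D" "monochromatic A \<alpha> \<gamma> (\<lambda>X. f (h ` X)) i"
    using monochromatic_relabel[OF _ f'] assms(4) by (auto simp: bij_betw_def)
  then show "\<exists>i\<in>D. monochromatic B \<alpha> \<gamma> f i"
    using monochromatic_image[OF assms(2,3), of _ _ f i] by blast
qed

lemma monochromatic_triangle:
  assumes "x \<in> A" "y \<in> A" "z \<in> A" "x \<noteq> y" "x \<noteq> z" "y \<noteq> z"
    and "f {x, y} = i" "f {x, z} = i" "f {y, z} = i"
  shows "monochromatic A 3 2 f i"
  unfolding monochromatic_def
proof
  show "{x, y, z} \<in> nsets A 3"
    using assms by (auto simp: nsets_def)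
  show "f ` nsets {x, y, z} 2 \<subseteq> {i}"
    using assms by (auto simp: nsets_2_eq insert_commute)
qed

lemma ramsey3_le: "N > 0 \<Longrightarrow> partn {..<N} 3 2 {..<n} \<Longrightarrow> ramsey3 n \<le> N"
  unfolding ramsey3_def by (rule Least_le) simp

text \<open>Fix the vertex 0. Some colour \<open>i\<close> joins it to at least
  \<open>ramsey3 n\<close> vertices. Either an edge of colour \<open>i\<close> among these closes a
  triangle with 0, or only \<open>n\<close> colours occur among them.\<close>

lemma ramsey3_Suc_le: "ramsey3 (Suc n) \<le> Suc n * (ramsey3 n - 1) + 2"
proof (rule ramsey3_le)
  define M where "M = ramsey3 n"
  \<comment> \<open>All vertices except 0. Their number exceeds \<open>Suc n * (M - 1)\<close> by
    one, which is what forces a colour class of size \<open>M\<close>.\<close>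
  define V where "V = {1..<Suc n * (M - 1) + 2}"
  let ?U = "{..<Suc n * (ramsey3 n - 1) + 2}"
  have VU: "V \<subseteq> ?U" "0 \<in> ?U" "\<And>v. v \<in> V \<Longrightarrow> 0 < v"
    by (auto simp: V_def M_def)
  show "partn ?U 3 2 {..<Suc n}"
    unfolding partn_def
  proof
    fix f assume f: "f \<in> nsets ?U 2 \<rightarrow> {..<Suc n}"
    define F where "F i = {v \<in> V. f {0, v} = i}" for i
    have F0: "f {0, v} < Suc n" if "v \<in> V" for v
    proof -
      have "{0, v} \<in> nsets ?U 2"
        using that VU by auto
      then show ?thesis
        using f by blast
    qed
    have "\<exists>i\<in>{..<Suc n}. card ((\<lambda>v. f {0, v}) -` {i} \<inter> V) * card {..<Suc n} \<ge> card V"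
      using F0 by (intro pigeonhole_card) (auto simp: V_def)
    then obtain i where i: "i < Suc n" and "card V \<le> card (F i) * Suc n"
      by (auto simp: F_def vimage_def Int_def conj_commute)
    then have "Suc n * (M - 1) < Suc n * card (F i)"
      by (simp add: V_def mult.commute)
    then have card_F: "M \<le> card (F i)"
      unfolding mult_less_cancel1 by linarith
    show "\<exists>i\<in>{..<Suc n}. monochromatic ?U 3 2 f i"
    proof (cases "\<exists>y\<in>F i. \<exists>z\<in>F i. y \<noteq> z \<and> f {y, z} = i")
      case True
      then obtain y z where "y \<in> F i" "z \<in> F i" "y \<noteq> z" "f {y, z} = i"
        by blast
      then have "monochromatic ?U 3 2 f i"
        using VU by (intro monochromatic_triangle[of 0 _ y z]) (auto simp: F_def)
      then show ?thesis
        using i by blast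
    next
      case False
      let ?D = "{..<Suc n} - {i}"
      have FU: "F i \<subseteq> ?U"
        using VU by (auto simp: F_def)
      have "f \<in> nsets (F i) 2 \<rightarrow> ?D"
      proof
        fix e assume e: "e \<in> nsets (F i) 2"
        then have "f e \<noteq> i"
          using False by (auto elim!: nsets2_E)
        moreover have "f e \<in> {..<Suc n}"
          using f e nsets_mono[OF FU] by blast
        ultimately show "f e \<in> ?D"
          by simp
      qed
      \<comment> \<open>\<open>F i\<close> contains a copy of \<open>{..<M}\<close>, and removing
        \<open>i\<close> leaves exactly \<open>n\<close> colours.\<close>
      moreover have "partn (F i) 3 2 ?D"
      proof -
        have "finite (F i)"
          by (simp add: F_def V_def)
        then obtain h where h: "inj_on h {..<M}" "h ` {..<M} \<subseteq> F i"
          using card_F card_le_inj[of "{..<M}" "F i"] by auto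
        have "card ?D = card {..<n}"
          using i by simp
        then obtain g where g: "bij_betw g ?D {..<n}"
          using finite_same_card_bij[of ?D "{..<n}"] by auto
        show ?thesis
          using ramsey3(2)[of n] h g unfolding M_def by (rule partn_transfer)
      qed
      ultimately obtain j where "j \<in> ?D" "monochromatic (F i) 3 2 f j"
        unfolding partn_def by blast
      moreover from this have "monochromatic ?U 3 2 f j"
        unfolding monochromatic_def using nsets_mono[OF FU] by blast
      ultimately show ?thesis
        by blast
    qed
  qed
qed simp

text \<open>Passing to \<open>Suc n\<close> multiplies the previous value by \<open>Suc n\<close>
  and adds 1 for the new term. Integrality is what later pins down the floor.\<close>

lemma fact_mult_sum_inverse_fact_in_Nats:
  "fact n * (\<Sum>j\<le>n. 1 / fact j) \<in> (\<nat> :: real set)"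
proof (induction n)
  case (Suc n)
  have "fact (Suc n) * (\<Sum>j\<le>Suc n. 1 / fact j) =
      of_nat (Suc n) * (fact n * (\<Sum>j\<le>n. 1 / fact j)) + (1::real)"
    using of_nat_neq_0[of n, where 'a = real] by (simp add: distrib_left del: of_nat_Suc)
  then show ?case
    using Suc by (metis Nats_1 Nats_add Nats_mult of_nat_in_Nats)
qed simp

lemma sum_inverse_fact_le_exp_1: "(\<Sum>j\<le>n. 1 / fact j) \<le> exp (1::real)"
proof -
  have "exp 1 = (\<Sum>j. inverse (fact j) :: real)"
    using fun_cong[OF exp_def, of "1::real"] by simp
  moreover have "(\<Sum>j\<le>n. inverse (fact j) :: real) \<le> (\<Sum>j. inverse (fact j))"
    using summable_exp[of "1::real"] by (intro sum_le_suminf) auto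
  ultimately show ?thesis
    by (simp add: inverse_eq_divide)
qed

text \<open>The right-hand side is an integer, and the tail of the series for e, multiplied by
  \<open>fact k\<close>, is less than 1.\<close>

lemma floor_fact_mult_exp_1_le:
  assumes "k \<ge> 2"
  shows "real_of_int \<lfloor>fact k * exp (1::real)\<rfloor> \<le> fact k * (\<Sum>j\<le>k. 1 / fact j)"
proof -
  \<comment> \<open>Lagrange form of the remainder; times \<open>fact k\<close> it is
    \<open>exp t / (k + 1)\<close>.\<close>
  obtain t :: real where t: "\<bar>t\<bar> < 1"
    "exp 1 = (\<Sum>j<Suc k. 1 / fact j) + exp t / fact (Suc k)"
    using Maclaurin_exp_lt[of 1 "Suc k"] by auto
  have "exp t < exp 1"
    using t(1) by simp
  \<comment> \<open>Here \<open>k \<ge> 2\<close> enters: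
    \<open>exp 1 \<le> 3 \<le> Suc k\<close>.\<close>
  then have "exp t < real (Suc k)"
    using exp_le assms by linarith
  then have "fact k * (exp t / fact (Suc k)) < 1"
    by (simp add: divide_less_eq del: of_nat_Suc)
  then have "fact k * exp 1 < fact k * (\<Sum>j\<le>k. 1 / fact j) + (1::real)"
    unfolding t(2) lessThan_Suc_atMost by (simp only: distrib_left)
  moreover obtain m where m: "fact k * (\<Sum>j\<le>k. 1 / fact j) = real m"
    using fact_mult_sum_inverse_fact_in_Nats by (metis Nats_cases)
  ultimately have "\<lfloor>fact k * exp (1::real)\<rfloor> < int m + 1"
    unfolding floor_less_iff by simp
  then show ?thesis
    using m by simp
qed

theorem theorem2p5:
  fixes k a :: nat and q :: real
  assumes "k \<ge> 2"
    and "int a \<le> \<lfloor>fact k * exp (1::real)\<rfloor> - int (ramsey3 k) + 1"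
    and "q = real a / fact k"
  shows "\<forall>n\<ge>k. real (ramsey3 n) \<le> fact n * (exp 1 - q) + 1"
proof (intro allI impI)
  fix n assume "n \<ge> k"
  \<comment> \<open>The partial sum replaces e because the bound with e does not reproduce itself:
    the recurrence leaves a surplus of 1 at each step.\<close>
  then have "real (ramsey3 n) \<le> fact n * ((\<Sum>j\<le>n. 1 / fact j) - q) + 1"
  proof (induction rule: dec_induct)
    case base
    have "real_of_int (int a) \<le> real_of_int (\<lfloor>fact k * exp (1::real)\<rfloor> - int (ramsey3 k) + 1)"
      using assms(2) by (simp only: of_int_le_iff)
    then show ?case
      using floor_fact_mult_exp_1_le[OF assms(1)] unfolding assms(3) right_diff_distrib by simp
  next
    case (step n)
    have "real (ramsey3 (Suc n)) \<le> real (Suc n * (ramsey3 n - 1) + 2)"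
      using ramsey3_Suc_le by (simp only: of_nat_le_iff)
    \<comment> \<open>Positivity of \<open>ramsey3 n\<close> makes the truncated subtraction a true
      one.\<close>
    also have "\<dots> = real (Suc n) * (real (ramsey3 n) - 1) + 2"
      using ramsey3(1)[of n] by (simp add: of_nat_diff Suc_leI del: mult_Suc)
    also have "\<dots> \<le> real (Suc n) * (fact n * ((\<Sum>j\<le>n. 1 / fact j) - q)) + 2"
      using step.IH by (intro add_right_mono mult_left_mono) auto
    \<comment> \<open>One unit of the 2 is absorbed as \<open>fact (Suc n)\<close> times the new
      summand \<open>1 / fact (Suc n)\<close>.\<close>
    also have "\<dots> = fact (Suc n) * ((\<Sum>j\<le>Suc n. 1 / fact j) - q) + 1"
      by (simp add: algebra_simps del: of_nat_Suc)
    finally show ?case .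
  qed
  also have "\<dots> \<le> fact n * (exp 1 - q) + 1"
    using sum_inverse_fact_le_exp_1[of n] by (intro add_right_mono mult_left_mono) auto
  finally show "real (ramsey3 n) \<le> fact n * (exp 1 - q) + 1" .
qed

end
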